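(* Let $T\ge1$, and let $\widehat{\mathcal G}$ be the class of all $(T+1)$-layer SNOK functions $g:\mathcal{X}\to\mathbb{R}$ (with $\mathcal X\subseteq\mathbb{R}^d$) whose last-layer weight satisfies $\|\mathbf w\|_2\le\mathcal B_w$, where the activation $h$ satisfies $|h(y)|\le|y|$ element-wise. Let $\ell(z,y):\mathcal Z\times\mathcal Y\to[0,1]$, $\mathcal Z=\mathbb{R}$, be a loss function that is Lipschitz in $z$ with constant $L$, and let $\widetilde\ell(z,y)=\ell(z,y)-\ell(0,y)$. Let $(x_i,y_i)_{i=1}^N$ be (i.i.d.) samples from $\mathcal X\times\mathcal Y$, $X=[x_1,\dots,x_N]$, and let $\mu^*\le1$ be the mutual coherence of the output $Y_{T+1}=[y_{T+1}^{(1)},\dots,y_{T+1}^{(N)}]$ of the $T$-th layer on input $X$. Then $$\mathfrak R_N(\widetilde\ell\circ\widehat{\mathcal G})=\frac1N\,\mathbb{E}\Big[\sup_{g\in\widehat{\mathcal G}}\sum_{i=1}^N\epsilon_i\,\widetilde\ell(g(x_i),y_i)\Big]\le\frac{L\,\mathcal B_w\sqrt{\big((N-1)\mu^*+1\big)T}}{N}\,\|X\|_F ,$$ where $\epsilon_1,\dots,\epsilon_N$ are i.i.d. uniform on $\{+1,-1\}$, the expectation is over the $\epsilon_i$ given the sample, and $\|\cdot\|_F$ is the Frobenius norm.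
   Context: SNOK network: given input $x\in\mathbb{R}^d$, set $y_1=0\in\mathbb{R}^{M}$ and, for $t=1,\dots,T$, $$y_{t+1}=h\big(D^\top R_t x+(I_M-D^\top D)y_t\big),$$ and the last, $(T+1)$-th, layer outputs $g(x)=\mathbf w^\top y_{T+1}$, $\mathbf w\in\mathbb{R}^M$. The free parameters are $\mathbf w$ and the orthogonal matrices $R_1,\dots,R_T\in\mathbb{R}^{d\times d}$ ($R_t^\top R_t=R_tR_t^\top=I_d$). The matrix $D\in\mathbb{R}^{d\times M}$ is a fixed scaled structured spherical sample matrix with $DD^\top=I_d$: with $d=2m$, $M=2n$ and an index set $\Lambda=\{k_1,\dots,k_m\}\subset\{1,\dots,n-1\}$ of size $m$, let $F_\Lambda\in\mathbb{C}^{m\times n}$ have entries $(F_\Lambda)_{r,j}=\frac1{\sqrt n}e^{2\pi\mathbf i k_r j/n}$, $1\le r\le m$, $1\le j\le n$, and $$D=\begin{bmatrix}\operatorname{Re}F_\Lambda&-\operatorname{Im}F_\Lambda\\ \operatorname{Im}F_\Lambda&\operatorname{Re}F_\Lambda\end{bmatrix}.$$ The activation $h:\mathbb{R}^M\to\mathbb{R}^M$ is a fixed map with $|h(y)_i|\le|y_i|$ for every coordinate $i$. The mutual coherence of a matrix $Y$ with columns $y^{(i)}$ is $\mu(Y)=\max_{i\ne j}\frac{|y^{(i)\top}y^{(j)}|}{\|y^{(i)}\|_2\|y^{(j)}\|_2}$ (pairs containing a zero column are ignored; the value is $0$ if there are no remaining pairs). Since $Y_{T+1}$ depends on $R_1,\dots,R_T$,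 $\mu^*$ is the supremum of $\mu(Y_{T+1})$ over all admissible $R_1,\dots,R_T$, for the given sample $X$. *)

theory Defs
  imports "HOL-Probability.Probability" "HOL-Probability.Product_PMF"
begin

text \<open>
  Dimensions are index types: \<open>m = CARD('m)\<close>, \<open>n = CARD('n)\<close>, so that
  $\mathbb{R}^{2m}$ is \<open>real ^ ('m + 'm)\<close> and $\mathbb{R}^{2n}$ is \<open>real ^ ('n + 'n)\<close>.
  The function \<open>k\<close> lists the frequencies $k_1,\ldots,k_m$, and \<open>col\<close> numbers the elements of
  \<open>'n\<close> by $1,\ldots,n$ (it is required to be a bijection where these definitions are used).
\<close>

definition fourier_rows :: "('m::finite \<Rightarrow> nat) \<Rightarrow> ('n::finite \<Rightarrow> nat) \<Rightarrow> complex ^ 'n ^ 'm" where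
  "fourier_rows k col =
     (\<chi> r j. complex_of_real (1 / sqrt (real CARD('n))) *
        exp (2 * complex_of_real pi * \<i> * of_nat (k r) * of_nat (col j) / of_nat CARD('n)))"

definition spherical_matrix ::
    "('m::finite \<Rightarrow> nat) \<Rightarrow> ('n::finite \<Rightarrow> nat) \<Rightarrow> real ^ ('n + 'n) ^ ('m + 'm)" where
  "spherical_matrix k col = (let F = fourier_rows k col in
     (\<chi> a b. case a of
        Inl r \<Rightarrow> (case b of Inl j \<Rightarrow> Re (F $ r $ j) | Inr j \<Rightarrow> - Im (F $ r $ j))
      | Inr r \<Rightarrow> (case b of Inl j \<Rightarrow> Im (F $ r $ j) | Inr j \<Rightarrow> Re (F $ r $ j))))"

text \<open>The state \<open>snok_state D h R x t\<close> is $y_{t+1}$; the recursion starts at $y_1 = 0$.\<close>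

primrec snok_state ::
    "real ^ 'M ^ 'd \<Rightarrow> (real ^ 'M \<Rightarrow> real ^ 'M) \<Rightarrow> (nat \<Rightarrow> real ^ 'd ^ 'd) \<Rightarrow> real ^ 'd
      \<Rightarrow> nat \<Rightarrow> real ^ 'M" where
  "snok_state D h R x 0 = 0"
| "snok_state D h R x (Suc t) =
     h ((transpose D ** R (Suc t)) *v x + (mat 1 - transpose D ** D) *v snok_state D h R x t)"

definition admissible :: "nat \<Rightarrow> (nat \<Rightarrow> real ^ 'd ^ 'd) set" where
  "admissible T = {R. \<forall>t\<in>{1..T}. orthogonal_matrix (R t)}"

definition snok_class ::
    "real ^ 'M ^ 'd \<Rightarrow> (real ^ 'M \<Rightarrow> real ^ 'M) \<Rightarrow> nat \<Rightarrow> real \<Rightarrow> (real ^ 'd) set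
      \<Rightarrow> (real ^ 'd \<Rightarrow> real) set" where
  "snok_class D h T B \<X> =
     {restrict (\<lambda>x. w \<bullet> snok_state D h R x T) \<X> | w R. norm w \<le> B \<and> R \<in> admissible T}"

definition mutual_coherence :: "nat \<Rightarrow> (nat \<Rightarrow> real ^ 'M) \<Rightarrow> real" where
  "mutual_coherence N Y =
     (let S = {\<bar>Y i \<bullet> Y j\<bar> / (norm (Y i) * norm (Y j)) | i j.
                 i \<in> {1..N} \<and> j \<in> {1..N} \<and> i \<noteq> j \<and> Y i \<noteq> 0 \<and> Y j \<noteq> 0}
      in if S = {} then 0 else Max S)"

definition snok_coherence ::
    "real ^ 'M ^ 'd \<Rightarrow> (real ^ 'M \<Rightarrow> real ^ 'M) \<Rightarrow> nat \<Rightarrow> nat \<Rightarrow> (nat \<Rightarrow> real ^ 'd) \<Rightarrow> real" where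
  "snok_coherence D h T N x =
     (SUP R\<in>admissible T. mutual_coherence N (\<lambda>i. snok_state D h R (x i) T))"

definition frobenius_norm :: "nat \<Rightarrow> (nat \<Rightarrow> real ^ 'd) \<Rightarrow> real" where
  "frobenius_norm N x = sqrt (\<Sum>i = 1..N. \<Sum>a\<in>UNIV. (x i $ a)\<^sup>2)"

definition shifted_loss :: "(real \<Rightarrow> 'y \<Rightarrow> real) \<Rightarrow> real \<Rightarrow> 'y \<Rightarrow> real" where
  "shifted_loss l z y = l z y - l 0 y"

definition loss_class :: "(real \<Rightarrow> 'y \<Rightarrow> real) \<Rightarrow> ('x \<Rightarrow> real) set \<Rightarrow> ('x \<times> 'y \<Rightarrow> real) set" where
  "loss_class l G = (\<lambda>g (x, y). l (g x) y) ` G"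

definition rademacher_signs :: "nat \<Rightarrow> (nat \<Rightarrow> real) pmf" where
  "rademacher_signs N = Pi_pmf {1..N} 0 (\<lambda>_. pmf_of_set {1, -1})"

definition rademacher_complexity :: "nat \<Rightarrow> (nat \<Rightarrow> 'z) \<Rightarrow> ('z \<Rightarrow> real) set \<Rightarrow> real" where
  "rademacher_complexity N s F =
     1 / real N * measure_pmf.expectation (rademacher_signs N)
       (\<lambda>\<epsilon>. SUP f\<in>F. \<Sum>i = 1..N. \<epsilon> i * f (s i))"

text \<open>
  The supremum in \<open>snok_coherence\<close> is taken over a nonempty family of numbers in \<open>[0, 1]\<close>, so it
  is a genuine supremum and is itself in \<open>[0, 1]\<close>.
\<close>

lemma mutual_coherence_bounds: "0 \<le> mutual_coherence N Y \<and> mutual_coherence N Y \<le> 1"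
proof -
  define S where "S = {\<bar>Y i \<bullet> Y j\<bar> / (norm (Y i) * norm (Y j)) | i j.
      i \<in> {1..N} \<and> j \<in> {1..N} \<and> i \<noteq> j \<and> Y i \<noteq> 0 \<and> Y j \<noteq> 0}"
  have "S \<subseteq> (\<lambda>(i, j). \<bar>Y i \<bullet> Y j\<bar> / (norm (Y i) * norm (Y j))) ` ({1..N} \<times> {1..N})"
    unfolding S_def by auto
  then have fin: "finite S"
    by (rule finite_subset) simp
  have bnd: "0 \<le> s \<and> s \<le> 1" if "s \<in> S" for s
    using that unfolding S_def
    by (auto simp: Cauchy_Schwarz_ineq2 intro!: divide_le_eq_1_pos[THEN iffD2])
  have "mutual_coherence N Y = (if S = {} then 0 else Max S)"
    unfolding mutual_coherence_def S_def Let_def ..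
  then show ?thesis
    using bnd Max_in[OF fin] by auto
qed

lemma admissible_nonempty: "admissible T \<noteq> {}"
proof -
  have "(\<lambda>_. mat 1) \<in> admissible T"
    by (simp add: admissible_def orthogonal_matrix_id)
  then show ?thesis by blast
qed

lemma snok_coherence_bounds: "0 \<le> snok_coherence D h T N x \<and> snok_coherence D h T N x \<le> 1"
proof
  let ?c = "\<lambda>R. mutual_coherence N (\<lambda>i. snok_state D h R (x i) T)"
  have bdd: "bdd_above (?c ` admissible T)"
    using mutual_coherence_bounds by (intro bdd_aboveI2[where M = 1]) blast
  show "snok_coherence D h T N x \<le> 1"
    unfolding snok_coherence_def
    using mutual_coherence_bounds by (intro cSUP_least admissible_nonempty) blast
  obtain R where R: "R \<in> admissible T" and "0 \<le> ?c R"
    using admissible_nonempty mutual_coherence_bounds by blast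
  then show "0 \<le> snok_coherence D h T N x"
    unfolding snok_coherence_def using cSUP_upper2[OF bdd R] by blast
qed

end

theory Submission
  imports Defs
begin

text \<open>
  The contraction principle replaces the loss by multiplication with its Lipschitz constant. Since
  the rows of the dictionary are orthonormal, each layer adds at most $\|x\|^2$ to the squared norm
  of the state, so the final states satisfy $\|y_{T+1}^{(i)}\|^2 \le T \|x_i\|^2$. Bounding the
  off-diagonal Gram entries of the final states by the coherence gives
  $\|\sum_i \epsilon_i y_{T+1}^{(i)}\|^2 \le ((N-1)\mu^* + 1)\, T\, \|X\|_F^2$ for every choice of
  signs, and Cauchy--Schwarz against the last-layer weight concludes.
\<close>

section \<open>Random signs and the Rademacher contraction principle\<close>

lemma finite_set_pmf_Pi_pmf:
  assumes "finite A" "\<And>i. i \<in> A \<Longrightarrow> finite (set_pmf (p i))"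
  shows "finite (set_pmf (Pi_pmf A d p))"
  unfolding set_Pi_pmf[OF assms(1)] using assms by (intro finite_PiE_dflt) auto

text \<open>Conditioning on the sign of \<open>j\<close>: a sign vector on \<open>insert j A\<close>
  is one on \<open>A\<close> whose coordinate \<open>j\<close>, previously at its default 0, is
  overwritten by an independent fair sign. This drives the induction over coordinates.\<close>

lemma expectation_Pi_pmf_insert_sign:
  fixes f :: "('i \<Rightarrow> real) \<Rightarrow> real"
  assumes "finite A" "j \<notin> A"
  shows "measure_pmf.expectation (Pi_pmf (insert j A) 0 (\<lambda>_. pmf_of_set {1, -1})) f =
    (measure_pmf.expectation (Pi_pmf A 0 (\<lambda>_. pmf_of_set {1, -1})) (\<lambda>e. f (e(j := 1))) +
     measure_pmf.expectation (Pi_pmf A 0 (\<lambda>_. pmf_of_set {1, -1})) (\<lambda>e. f (e(j := -1)))) / 2"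
proof -
  let ?P = "Pi_pmf A 0 (\<lambda>_. pmf_of_set {1, -1 :: real})"
  have eq: "Pi_pmf (insert j A) 0 (\<lambda>_. pmf_of_set {1, -1 :: real}) =
      pmf_of_set {1, -1} \<bind> (\<lambda>s. map_pmf (\<lambda>e. e(j := s)) ?P)"
    using assms by (subst Pi_pmf_insert') (auto simp: map_pmf_def)
  have fin: "finite (set_pmf ?P)"
    using assms(1) by (intro finite_set_pmf_Pi_pmf) auto
  show ?thesis
    unfolding eq by (subst pmf_expectation_bind_pmf_of_set) (auto simp: fin field_simps)
qed

text \<open>Contraction for a single sign, with the average over that sign written as a sum of two
  suprema. Such a sum is controlled through pairs \<open>g\<close>, \<open>g'\<close>, and for a
  pair the Lipschitz bound on the difference of \<open>\<phi>\<close> values is one of two linear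
  differences. The bounds \<open>U\<close> and \<open>C\<close> make the suprema on the right
  genuine ones.\<close>

lemma SUP_contraction_step:
  fixes u a :: "'g \<Rightarrow> real" and \<phi> :: "real \<Rightarrow> real"
  assumes "G \<noteq> {}" and lip: "L-lipschitz_on UNIV \<phi>"
    and u: "\<And>g. g \<in> G \<Longrightarrow> \<bar>u g\<bar> \<le> U" and a: "\<And>g. g \<in> G \<Longrightarrow> \<bar>a g\<bar> \<le> C"
  shows "(SUP g\<in>G. u g + \<phi> (a g)) + (SUP g\<in>G. u g - \<phi> (a g)) \<le>
    (SUP g\<in>G. u g + L * a g) + (SUP g\<in>G. u g - L * a g)" (is "_ \<le> ?p + ?q")
proof -
  have "0 \<le> L" using lip by (rule lipschitz_on_nonneg)
  have La: "\<bar>L * a g\<bar> \<le> L * C" if "g \<in> G" for g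
    using a[OF that] \<open>0 \<le> L\<close> by (simp add: abs_mult mult_left_mono)
  have p: "u g + L * a g \<le> ?p" if "g \<in> G" for g
    using that
  proof (rule cSUP_upper)
    show "bdd_above ((\<lambda>g. u g + L * a g) ` G)"
    proof (rule bdd_aboveI2)
      fix g assume "g \<in> G"
      with u[OF this] La[OF this] show "u g + L * a g \<le> U + L * C" by linarith
    qed
  qed
  have q: "u g - L * a g \<le> ?q" if "g \<in> G" for g
    using that
  proof (rule cSUP_upper)
    show "bdd_above ((\<lambda>g. u g - L * a g) ` G)"
    proof (rule bdd_aboveI2)
      fix g assume "g \<in> G"
      with u[OF this] La[OF this] show "u g - L * a g \<le> U + L * C" by linarith
    qed
  qed
  have pair: "(u g + \<phi> (a g)) + (u g' - \<phi> (a g')) \<le> ?p + ?q" if "g \<in> G" "g' \<in> G" for g g'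
  proof -
    have "\<bar>\<phi> (a g) - \<phi> (a g')\<bar> \<le> L * \<bar>a g - a g'\<bar>"
      using lipschitz_onD[OF lip, of "a g" "a g'"] by (simp add: dist_real_def)
    then have "\<phi> (a g) - \<phi> (a g') \<le> L * \<bar>a g - a g'\<bar>"
      by linarith
    also have "\<dots> = max (L * a g - L * a g') (L * a g' - L * a g)"
    proof (cases "a g \<le> a g'")
      case True
      then show ?thesis
        using mult_left_mono[OF True \<open>0 \<le> L\<close>] by (simp add: right_diff_distrib max_def)
    next
      case False
      then show ?thesis
        using mult_left_mono[of "a g'" "a g" L] \<open>0 \<le> L\<close> by (simp add: right_diff_distrib max_def)
    qed
    \<comment> \<open>The right side of the claim is symmetric in \<open>g\<close> and
      \<open>g'\<close>, so either branch of the maximum is covered: one puts \<open>g\<close> in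
      \<open>?p\<close> and \<open>g'\<close> in \<open>?q\<close>, the other swaps them.\<close>
    finally show ?thesis
      using p[OF that(1)] p[OF that(2)] q[OF that(1)] q[OF that(2)] by linarith
  qed
  have "(SUP g\<in>G. u g + \<phi> (a g)) \<le> ?p + ?q - (u g' - \<phi> (a g'))" if "g' \<in> G" for g'
    using \<open>G \<noteq> {}\<close>
  proof (rule cSUP_least)
    fix g assume "g \<in> G"
    from pair[OF this that] show "u g + \<phi> (a g) \<le> ?p + ?q - (u g' - \<phi> (a g'))" by linarith
  qed
  then have "(SUP g\<in>G. u g - \<phi> (a g)) \<le> ?p + ?q - (SUP g\<in>G. u g + \<phi> (a g))"
    using \<open>G \<noteq> {}\<close> by (intro cSUP_least) (auto simp: algebra_simps)
  then show ?thesis by linarith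
qed

text \<open>Coordinates are linearised one at a time. The offset \<open>u\<close> is what makes the
  induction go through: it carries the terms not involved in the current replacement, so it must be
  arbitrary in the induction hypothesis.\<close>

lemma Rademacher_contraction:
  fixes u :: "'g \<Rightarrow> real" and a :: "'g \<Rightarrow> 'i \<Rightarrow> real" and \<phi> :: "'i \<Rightarrow> real \<Rightarrow> real"
  assumes "finite A" and "G \<noteq> {}"
    and "\<And>i. i \<in> A \<Longrightarrow> L-lipschitz_on UNIV (\<phi> i)"
    and "\<And>g. g \<in> G \<Longrightarrow> \<bar>u g\<bar> \<le> U"
    and "\<And>g i. g \<in> G \<Longrightarrow> i \<in> A \<Longrightarrow> \<bar>a g i\<bar> \<le> C i"
  shows "measure_pmf.expectation (Pi_pmf A 0 (\<lambda>_. pmf_of_set {1, -1}))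
      (\<lambda>e. SUP g\<in>G. u g + (\<Sum>i\<in>A. e i * \<phi> i (a g i))) \<le>
    measure_pmf.expectation (Pi_pmf A 0 (\<lambda>_. pmf_of_set {1, -1}))
      (\<lambda>e. SUP g\<in>G. u g + (\<Sum>i\<in>A. e i * (L * a g i)))"
  using assms(1,3-)
proof (induction A arbitrary: u U rule: finite_induct)
  case empty
  then show ?case by simp
next
  case (insert j A)
  let ?P = "Pi_pmf A 0 (\<lambda>_. pmf_of_set {1, -1 :: real})"
  let ?f = "\<lambda>e g. \<Sum>i\<in>A. e i * \<phi> i (a g i)"
  let ?l = "\<lambda>e g. \<Sum>i\<in>A. e i * (L * a g i)"
  have fin: "finite (set_pmf ?P)"
    using insert.hyps(1) by (intro finite_set_pmf_Pi_pmf) auto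
  have int: "integrable (measure_pmf ?P) f" for f :: "('i \<Rightarrow> real) \<Rightarrow> real"
    by (rule integrable_measure_pmf_finite[OF fin])
  have upd: "(\<Sum>i\<in>A. (e(j := s)) i * b i) = (\<Sum>i\<in>A. e i * b i)" for e b and s :: real
    using insert.hyps(2) by (intro sum.cong) auto
  have expand: "measure_pmf.expectation (Pi_pmf (insert j A) 0 (\<lambda>_. pmf_of_set {1, -1}))
      (\<lambda>e. SUP g\<in>G. u g + (\<Sum>i\<in>insert j A. e i * b g i)) =
    (measure_pmf.expectation ?P (\<lambda>e. SUP g\<in>G. u g + (b g j + (\<Sum>i\<in>A. e i * b g i))) +
     measure_pmf.expectation ?P (\<lambda>e. SUP g\<in>G. u g + (- b g j + (\<Sum>i\<in>A. e i * b g i)))) / 2" for b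
    unfolding expectation_Pi_pmf_insert_sign[OF insert.hyps] sum.insert[OF insert.hyps] upd
    by simp
  have "0 \<le> L"
    using insert.prems(1)[of j] lipschitz_on_nonneg by blast
  \<comment> \<open>A uniform bound on the nonlinear terms, obtained by comparison with the value at
    0; it bounds the offset used in the next step.\<close>
  have phi: "\<bar>\<phi> i (a g i)\<bar> \<le> \<bar>\<phi> i 0\<bar> + L * C i" if "g \<in> G" "i \<in> insert j A" for g i
  proof -
    have "\<bar>\<phi> i (a g i) - \<phi> i 0\<bar> \<le> L * \<bar>a g i\<bar>"
      using lipschitz_onD[OF insert.prems(1)[OF that(2)], of "a g i" 0] by (simp add: dist_real_def)
    also have "\<dots> \<le> L * C i"
      using insert.prems(3)[OF that] \<open>0 \<le> L\<close> by (rule mult_left_mono)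
    finally show ?thesis by linarith
  qed
  \<comment> \<open>Coordinate \<open>j\<close> is contracted first, with the sign vector on
    \<open>A\<close> frozen and the still nonlinear sum over \<open>A\<close> counted as
    offset.\<close>
  have step: "((SUP g\<in>G. (u g + ?f e g) + \<phi> j (a g j)) + (SUP g\<in>G. (u g + ?f e g) - \<phi> j (a g j))) \<le>
      ((SUP g\<in>G. (u g + ?f e g) + L * a g j) + (SUP g\<in>G. (u g + ?f e g) - L * a g j))" for e
  proof (rule SUP_contraction_step[OF \<open>G \<noteq> {}\<close>])
    show "L-lipschitz_on UNIV (\<phi> j)" using insert.prems(1) by blast
    show "\<bar>a g j\<bar> \<le> C j" if "g \<in> G" for g using insert.prems(3) that by blast
    show "\<bar>u g + ?f e g\<bar> \<le> U + (\<Sum>i\<in>A. \<bar>e i\<bar> * (\<bar>\<phi> i 0\<bar> + L * C i))" if "g \<in> G" for g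
    proof -
      have "\<bar>?f e g\<bar> \<le> (\<Sum>i\<in>A. \<bar>e i\<bar> * \<bar>\<phi> i (a g i)\<bar>)"
        using sum_abs[of "\<lambda>i. e i * \<phi> i (a g i)" A] by (simp add: abs_mult)
      also have "\<dots> \<le> (\<Sum>i\<in>A. \<bar>e i\<bar> * (\<bar>\<phi> i 0\<bar> + L * C i))"
        using phi that by (intro sum_mono mult_left_mono) auto
      finally show ?thesis using insert.prems(2)[OF that] by linarith
    qed
  qed
  \<comment> \<open>Here the roles are exchanged: the linearised term of \<open>j\<close> joins the
    offset and the sum over \<open>A\<close> is contracted. Only \<open>s = 1\<close> and
    \<open>s = -1\<close> are used below.\<close>
  have IH: "measure_pmf.expectation ?P (\<lambda>e. SUP g\<in>G. (u g + s * (L * a g j)) + ?f e g) \<le>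
      measure_pmf.expectation ?P (\<lambda>e. SUP g\<in>G. (u g + s * (L * a g j)) + ?l e g)" for s
  proof (rule insert.IH)
    show "\<bar>u g + s * (L * a g j)\<bar> \<le> U + \<bar>s\<bar> * (L * C j)" if "g \<in> G" for g
    proof -
      have "\<bar>s * (L * a g j)\<bar> \<le> \<bar>s\<bar> * (L * C j)"
        using insert.prems(3)[OF that, of j] \<open>0 \<le> L\<close> by (auto simp: abs_mult intro!: mult_left_mono)
      with insert.prems(2)[OF that] show ?thesis by linarith
    qed
  qed (use insert.prems in auto)
  have "measure_pmf.expectation ?P (\<lambda>e. SUP g\<in>G. u g + (\<phi> j (a g j) + ?f e g)) +
        measure_pmf.expectation ?P (\<lambda>e. SUP g\<in>G. u g + (- \<phi> j (a g j) + ?f e g))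
      = measure_pmf.expectation ?P (\<lambda>e. (SUP g\<in>G. (u g + ?f e g) + \<phi> j (a g j)) +
          (SUP g\<in>G. (u g + ?f e g) - \<phi> j (a g j)))"
    by (subst Bochner_Integration.integral_add[OF int int]) (simp add: algebra_simps)
  also have "\<dots> \<le> measure_pmf.expectation ?P (\<lambda>e. (SUP g\<in>G. (u g + ?f e g) + L * a g j) +
          (SUP g\<in>G. (u g + ?f e g) - L * a g j))"
    by (intro integral_mono int step)
  also have "\<dots> = measure_pmf.expectation ?P (\<lambda>e. SUP g\<in>G. (u g + 1 * (L * a g j)) + ?f e g) +
        measure_pmf.expectation ?P (\<lambda>e. SUP g\<in>G. (u g + (-1) * (L * a g j)) + ?f e g)"
    by (subst Bochner_Integration.integral_add[OF int int]) (simp add: algebra_simps)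
  also have "\<dots> \<le> measure_pmf.expectation ?P (\<lambda>e. SUP g\<in>G. (u g + 1 * (L * a g j)) + ?l e g) +
        measure_pmf.expectation ?P (\<lambda>e. SUP g\<in>G. (u g + (-1) * (L * a g j)) + ?l e g)"
    by (intro add_mono IH)
  also have "\<dots> = measure_pmf.expectation ?P (\<lambda>e. SUP g\<in>G. u g + (L * a g j + ?l e g)) +
        measure_pmf.expectation ?P (\<lambda>e. SUP g\<in>G. u g + (- (L * a g j) + ?l e g))"
    by (simp add: algebra_simps)
  finally show ?case
    unfolding expand by (rule divide_right_mono) simp
qed

section \<open>Signed sums of vectors and their coherence\<close>

lemma inner_le_mutual_coherence:
  assumes "i \<in> {1..N}" "j \<in> {1..N}" "i \<noteq> j"
  shows "\<bar>Y i \<bullet> Y j\<bar> \<le> mutual_coherence N Y * (norm (Y i) * norm (Y j))"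
\<comment> \<open>Pairs with a zero column do not enter the coherence, but for them both sides
  vanish.\<close>
proof (cases "Y i = 0 \<or> Y j = 0")
  case False
  let ?r = "\<lambda>i j. \<bar>Y i \<bullet> Y j\<bar> / (norm (Y i) * norm (Y j))"
  define S where "S = {?r i j | i j. i \<in> {1..N} \<and> j \<in> {1..N} \<and> i \<noteq> j \<and> Y i \<noteq> 0 \<and> Y j \<noteq> 0}"
  have "S \<subseteq> (\<lambda>(i, j). ?r i j) ` ({1..N} \<times> {1..N})"
    unfolding S_def by auto
  then have fin: "finite S"
    by (rule finite_subset) simp
  have mem: "?r i j \<in> S"
    unfolding S_def using assms False by blast
  have "mutual_coherence N Y = Max S"
    unfolding mutual_coherence_def S_def[symmetric] using mem by auto
  then have "?r i j \<le> mutual_coherence N Y"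
    using Max_ge[OF fin mem] by simp
  then show ?thesis
    using False by (simp add: divide_le_eq)
qed auto

text \<open>Expanding the square gives the signed Gram entries. Signs can only be lost by passing to
  absolute values, the off-diagonal entries are at most \<open>c\<close> times the product of norms,
  and Cauchy-Schwarz turns the squared sum of norms into \<open>N\<close> times the sum of their
  squares.\<close>

lemma norm_signed_sum_le_coherence:
  fixes Y :: "nat \<Rightarrow> real ^ 'M::finite"
  assumes c: "mutual_coherence N Y \<le> c" and e: "\<And>i. i \<in> {1..N} \<Longrightarrow> \<bar>e i\<bar> \<le> 1"
  shows "(norm (\<Sum>i = 1..N. e i *\<^sub>R Y i))\<^sup>2 \<le>
    ((real N - 1) * c + 1) * (\<Sum>i = 1..N. (norm (Y i))\<^sup>2)"
proof -
  have "0 \<le> c" using c mutual_coherence_bounds[of N Y] by linarith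
  let ?n = "\<lambda>i. norm (Y i)"
  \<comment> \<open>On the diagonal the squared norm is split into the weights \<open>c\<close> and
    \<open>1 - c\<close>. The weight \<open>c\<close> completes the off-diagonal part to a full
    double sum, which factors as a square.\<close>
  have entry: "(e i *\<^sub>R Y i) \<bullet> (e j *\<^sub>R Y j) \<le>
      c * (?n i * ?n j) + (if i = j then (1 - c) * (?n i)\<^sup>2 else 0)"
    if "i \<in> {1..N}" "j \<in> {1..N}" for i j
  proof -
    have "(e i *\<^sub>R Y i) \<bullet> (e j *\<^sub>R Y j) = (e i * e j) * (Y i \<bullet> Y j)"
      by simp
    also have "\<dots> \<le> \<bar>(e i * e j) * (Y i \<bullet> Y j)\<bar>"
      by (rule abs_ge_self)
    also have "\<dots> \<le> 1 * \<bar>Y i \<bullet> Y j\<bar>"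
      unfolding abs_mult using e[OF that(1)] e[OF that(2)]
      by (intro mult_right_mono mult_le_one) auto
    finally have *: "(e i *\<^sub>R Y i) \<bullet> (e j *\<^sub>R Y j) \<le> \<bar>Y i \<bullet> Y j\<bar>" by simp
    show ?thesis
    proof (cases "i = j")
      case True
      with * show ?thesis by (simp add: power2_norm_eq_inner algebra_simps flip: power2_eq_square)
    next
      case False
      have "\<bar>Y i \<bullet> Y j\<bar> \<le> mutual_coherence N Y * (?n i * ?n j)"
        by (rule inner_le_mutual_coherence[OF that False])
      also have "\<dots> \<le> c * (?n i * ?n j)"
        using c by (intro mult_right_mono) auto
      finally show ?thesis using * False by simp
    qed
  qed
  have "(norm (\<Sum>i = 1..N. e i *\<^sub>R Y i))\<^sup>2 = (\<Sum>i = 1..N. \<Sum>j = 1..N. (e i *\<^sub>R Y i) \<bullet> (e j *\<^sub>R Y j))"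
    unfolding power2_norm_eq_inner by (simp only: inner_sum_left inner_sum_right) (rule sum.swap)
  also have "\<dots> \<le> (\<Sum>i = 1..N. \<Sum>j = 1..N.
      c * (?n i * ?n j) + (if i = j then (1 - c) * (?n i)\<^sup>2 else 0))"
    by (intro sum_mono entry)
  also have "\<dots> = c * (\<Sum>i = 1..N. \<Sum>j = 1..N. ?n i * ?n j) + (1 - c) * (\<Sum>i = 1..N. (?n i)\<^sup>2)"
    by (simp add: sum.distrib sum_distrib_left)
  also have "(\<Sum>i = 1..N. \<Sum>j = 1..N. ?n i * ?n j) = (\<Sum>i = 1..N. ?n i)\<^sup>2"
    by (simp only: power2_eq_square sum_product)
  \<comment> \<open>The coefficients combine to \<open>c * N + (1 - c)\<close>, which is the factor
    claimed.\<close>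
  also have "c * (\<Sum>i = 1..N. ?n i)\<^sup>2 + (1 - c) * (\<Sum>i = 1..N. (?n i)\<^sup>2) \<le>
      c * (real N * (\<Sum>i = 1..N. (?n i)\<^sup>2)) + (1 - c) * (\<Sum>i = 1..N. (?n i)\<^sup>2)"
    using sum_squared_le_sum_of_squares[of ?n "{1..N}"] \<open>0 \<le> c\<close>
    by (intro add_right_mono mult_left_mono) (auto simp: mult.commute)
  finally show ?thesis by (simp add: algebra_simps)
qed

section \<open>Orthonormal rows of the spherical matrix\<close>

lemma sum_roots_of_unity_powers:
  fixes z :: complex
  assumes "z ^ n = 1" "z \<noteq> 1"
  shows "(\<Sum>j = 1..n. z ^ j) = 0"
proof -
  have "(\<Sum>j = 1..n. z ^ j) = z * (\<Sum>j<n. z ^ j)"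
    by (simp add: sum_distrib_left atLeastAtMostSuc_conv lessThan_atLeast0 flip: power_Suc)
      (metis atLeastLessThanSuc_atLeastAtMost sum.shift_bounds_Suc_ivl)
  then show ?thesis using assms by (simp add: geometric_sum)
qed

text \<open>The products of entries of two rows are powers of one root of unity \<open>z\<close>,
  divided by the number of columns. Summing over the columns \<open>1..n\<close> gives a full
  geometric sum, which vanishes unless \<open>z = 1\<close>, and distinct frequencies below
  \<open>n\<close> exclude that.\<close>

lemma fourier_rows_orthonormal:
  fixes k :: "'m::finite \<Rightarrow> nat" and col :: "'n::finite \<Rightarrow> nat"
  assumes inj: "inj k" and k: "range k \<subseteq> {1..<CARD('n)}" and col: "bij_betw col UNIV {1..CARD('n)}"
  shows "(\<Sum>j\<in>UNIV. fourier_rows k col $ r $ j * cnj (fourier_rows k col $ s $ j)) =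
    (if r = s then 1 else 0)"
proof -
  let ?N = "CARD('n)"
  define \<theta> where "\<theta> = 2 * pi * (real (k r) - real (k s)) / real ?N"
  define z where "z = exp (\<i> * of_real \<theta>)"
  have entry: "fourier_rows k col $ r $ j * cnj (fourier_rows k col $ s $ j) = z ^ col j / of_nat ?N" for j
  proof -
    let ?e = "\<lambda>r. exp (2 * complex_of_real pi * \<i> * of_nat (k r) * of_nat (col j) / of_nat ?N)"
    have arg: "2 * complex_of_real pi * \<i> * of_nat (k r) * of_nat (col j) / of_nat ?N +
        cnj (2 * complex_of_real pi * \<i> * of_nat (k s) * of_nat (col j) / of_nat ?N) =
        of_nat (col j) * (\<i> * of_real \<theta>)"
      by (simp add: \<theta>_def algebra_simps diff_divide_distrib)
    have "?e r * cnj (?e s) = z ^ col j"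
      unfolding z_def exp_of_nat_mult[symmetric] exp_cnj exp_add[symmetric] arg ..
    moreover have "complex_of_real (1 / sqrt (real ?N)) * complex_of_real (1 / sqrt (real ?N)) = 1 / of_nat ?N"
      by (simp flip: of_real_mult)
    ultimately have "(complex_of_real (1 / sqrt (real ?N)) * complex_of_real (1 / sqrt (real ?N))) *
        (?e r * cnj (?e s)) = z ^ col j / of_nat ?N"
      by simp
    then show ?thesis
      unfolding fourier_rows_def by (simp only: vec_lambda_beta complex_cnj_mult complex_cnj_complex_of_real mult_ac)
  qed
  have "(\<Sum>j\<in>UNIV. z ^ col j) = (\<Sum>j = 1..?N. z ^ j)"
    by (rule sum.reindex_bij_betw[OF col])
  then have sum: "(\<Sum>j\<in>UNIV. fourier_rows k col $ r $ j * cnj (fourier_rows k col $ s $ j)) =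
      (\<Sum>j = 1..?N. z ^ j) / of_nat ?N"
    unfolding entry by (simp flip: sum_divide_distrib)
  show ?thesis
  proof (cases "r = s")
    case True
    then have "z = 1" by (simp add: z_def \<theta>_def)
    with True show ?thesis unfolding sum by simp
  next
    case False
    have "z ^ ?N = exp (of_nat ?N * (\<i> * of_real \<theta>))"
      by (simp add: z_def exp_of_nat_mult)
    also have "of_nat ?N * (\<i> * of_real \<theta>) = 2 * of_int (int (k r) - int (k s)) * of_real pi * \<i>"
      by (simp add: \<theta>_def)
    also have "exp \<dots> = 1"
      by (subst exp_eq_1) (auto intro!: exI[of _ "int (k r) - int (k s)"])
    finally have pow: "z ^ ?N = 1" .
    \<comment> \<open>\<open>z = 1\<close> would make \<open>CARD('n)\<close> divide
      \<open>k r - k s\<close>. Both frequencies lie in \<open>{1..<CARD('n)}\<close>, so the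
      multiple is zero and injectivity of \<open>k\<close> gives \<open>r = s\<close>.\<close>
    have "z \<noteq> 1"
    proof
      assume "z = 1"
      then obtain q :: int where "\<theta> = of_int (2 * q) * pi"
        unfolding z_def exp_eq_1 by auto
      then have "(2 * pi) * (real (k r) - real (k s)) = (2 * pi) * (of_int q * real ?N)"
        by (simp add: \<theta>_def divide_eq_eq mult_ac)
      then have "real (k r) - real (k s) = of_int q * real ?N"
        by (rule mult_left_cancel[THEN iffD1, rotated]) simp
      then have q: "int (k r) - int (k s) = q * int ?N"
        by (metis (mono_tags, lifting) of_int_diff of_int_eq_iff of_int_mult of_int_of_nat_eq)
      have "k r < ?N" "k s < ?N" using k by (auto simp: image_subset_iff)
      then have "\<bar>q * int ?N\<bar> < int ?N" using q by linarith
      then have "q = 0"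
        by (cases "q = 0") (auto simp: abs_mult dest: mult_right_mono[of 1 "\<bar>q\<bar>" "int ?N"])
      with q have "k r = k s" by simp
      with inj False show False by (auto dest: injD)
    qed
    with False show ?thesis 
      unfolding sum sum_roots_of_unity_powers[OF pow \<open>z \<noteq> 1\<close>] by simp
  qed
qed

lemma sum_UNIV_Plus:
  fixes f :: "'a::finite + 'b::finite \<Rightarrow> 'c::comm_monoid_add"
  shows "sum f UNIV = (\<Sum>i\<in>UNIV. f (Inl i)) + (\<Sum>i\<in>UNIV. f (Inr i))"
  by (simp add: UNIV_Plus_UNIV[symmetric] sum.Plus del: UNIV_Plus_UNIV)

text \<open>The block form is the real representation of a complex matrix: the real part of the
  Hermitian orthogonality relation settles the diagonal blocks of the product, the imaginary part
  the off-diagonal ones.\<close>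

lemma spherical_matrix_mult_transpose:
  fixes k :: "'m::finite \<Rightarrow> nat" and col :: "'n::finite \<Rightarrow> nat"
  assumes "inj k" "range k \<subseteq> {1..<CARD('n)}" "bij_betw col UNIV {1..CARD('n)}"
  shows "spherical_matrix k col ** transpose (spherical_matrix k col) = mat 1"
proof -
  let ?F = "fourier_rows k col"
  note orth = fourier_rows_orthonormal[OF assms]
  have Re: "(\<Sum>j\<in>UNIV. Re (?F $ r $ j) * Re (?F $ s $ j)) + (\<Sum>j\<in>UNIV. Im (?F $ r $ j) * Im (?F $ s $ j))
      = (if r = s then 1 else 0)" for r s
    using arg_cong[OF orth[of r s], of Re] by (simp add: sum.distrib split: if_splits)
  have Im: "(\<Sum>j\<in>UNIV. Im (?F $ r $ j) * Re (?F $ s $ j)) = (\<Sum>j\<in>UNIV. Re (?F $ r $ j) * Im (?F $ s $ j))" for r s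
    using arg_cong[OF orth[of r s], of Im] by (simp add: sum_subtractf sum.distrib split: if_splits)
  show ?thesis
  proof (intro vec_eq_iff[THEN iffD2] allI)
    fix a b
    show "(spherical_matrix k col ** transpose (spherical_matrix k col)) $ a $ b = mat 1 $ a $ b"
      using Re Im
      by (cases a; cases b)
        (simp_all add: matrix_matrix_mult_def transpose_def spherical_matrix_def mat_def Let_def
          sum_UNIV_Plus sum_negf add.commute)
  qed
qed

section \<open>Growth of the state from layer to layer\<close>

lemma norm_le_if_abs_component_le:
  fixes v w :: "real ^ 'M::finite"
  assumes "\<And>i. \<bar>v $ i\<bar> \<le> \<bar>w $ i\<bar>"
  shows "norm v \<le> norm w"
  using assms by (intro norm_le_componentwise_cart) auto

text \<open>The hypothesis makes \<open>transpose D\<close> an isometry and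
  \<open>transpose D ** D\<close> the orthogonal projection onto its range, so the two summands are
  orthogonal. The exact value is |u|^2 + |v|^2 - |D v|^2, and the last term is dropped.\<close>

lemma norm_tight_frame_split:
  fixes D :: "real ^ 'M::finite ^ 'd::finite"
  assumes "D ** transpose D = mat 1"
  shows "(norm (transpose D *v u + (mat 1 - transpose D ** D) *v v))\<^sup>2 \<le> (norm u)\<^sup>2 + (norm v)\<^sup>2"
proof -
  have DDt: "D *v (transpose D *v c) = c" for c
    unfolding matrix_vector_mul_assoc assms by simp
  have adj: "(transpose D *v c) \<bullet> b = c \<bullet> (D *v b)" for b c
    by (simp add: transpose_matrix_vector dot_lmul_matrix)
  have adj': "b \<bullet> (transpose D *v c) = c \<bullet> (D *v b)" for b c
    by (subst inner_commute) (rule adj)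
  have proj: "(mat 1 - transpose D ** D) *v v = v - transpose D *v (D *v v)"
    by (simp add: matrix_vector_mult_diff_rdistrib matrix_vector_mul_assoc)
  have "(norm (transpose D *v u + (mat 1 - transpose D ** D) *v v))\<^sup>2 =
      (norm u)\<^sup>2 + (norm v)\<^sup>2 - (norm (D *v v))\<^sup>2"
    unfolding proj power2_norm_eq_inner
    by (simp add: inner_add_left inner_add_right inner_diff_left inner_diff_right adj adj' DDt
        matrix_vector_right_distrib matrix_vector_mult_diff_distrib inner_commute del: transpose_matrix_vector)
  then show ?thesis by simp
qed

text \<open>Starting from the zero state, each layer adds at most |x|^2: the activation does not
  increase the norm and the orthogonal factor preserves that of \<open>x\<close>. The restriction
  \<open>t \<le> T\<close> is there because \<open>admissible T\<close> constrains only the matrices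
  with indices \<open>1..T\<close>.\<close>

lemma norm_snok_state_le:
  fixes D :: "real ^ 'M::finite ^ 'd::finite"
  assumes D: "D ** transpose D = mat 1" and h: "\<And>v i. \<bar>h v $ i\<bar> \<le> \<bar>v $ i\<bar>"
    and R: "R \<in> admissible T" and "t \<le> T"
  shows "(norm (snok_state D h R x t))\<^sup>2 \<le> real t * (norm x)\<^sup>2"
  using \<open>t \<le> T\<close>
proof (induction t)
  case (Suc t)
  have "orthogonal_transformation ((*v) (R (Suc t)))"
    using R Suc.prems by (simp add: admissible_def orthogonal_transformation_matrix)
  then have R_iso: "norm (R (Suc t) *v x) = norm x"
    by (rule orthogonal_transformation_norm)
  let ?v = "snok_state D h R x t"
  let ?p = "transpose D *v (R (Suc t) *v x) + (mat 1 - transpose D ** D) *v ?v"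
  have "(norm (snok_state D h R x (Suc t)))\<^sup>2 = (norm (h ?p))\<^sup>2"
    by (simp add: matrix_vector_mul_assoc)
  also have "\<dots> \<le> (norm ?p)\<^sup>2"
    by (intro power_mono norm_le_if_abs_component_le h) auto
  also have "\<dots> \<le> (norm (R (Suc t) *v x))\<^sup>2 + (norm ?v)\<^sup>2"
    by (rule norm_tight_frame_split[OF D])
  finally show ?case
    using Suc by (simp add: R_iso algebra_simps)
qed simp

section \<open>Bounds over the network class and the final estimate\<close>

lemma frobenius_norm_power2: "(frobenius_norm N x)\<^sup>2 = (\<Sum>i = 1..N. (norm (x i))\<^sup>2)"
  unfolding frobenius_norm_def
  by (subst real_sqrt_pow2) (auto intro!: sum_nonneg simp: norm_vec_def L2_set_def sum_nonneg)

lemma mutual_coherence_le_snok_coherence: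
  assumes "R \<in> admissible T"
  shows "mutual_coherence N (\<lambda>i. snok_state D h R (x i) T) \<le> snok_coherence D h T N x"
  unfolding snok_coherence_def
proof (rule cSUP_upper[OF assms])
  show "bdd_above ((\<lambda>R. mutual_coherence N (\<lambda>i. snok_state D h R (x i) T)) ` admissible T)"
    using mutual_coherence_bounds by (intro bdd_aboveI2[where M = 1]) blast
qed

text \<open>By linearity in \<open>w\<close> the signed sum is an inner product with the signed sum
  of states. The bound is the same for all \<open>g\<close> and all signs, so it survives both the
  supremum and the expectation.\<close>

lemma signed_sum_snok_class_le:
  fixes D :: "real ^ 'M::finite ^ 'd::finite"
  assumes D: "D ** transpose D = mat 1" and h: "\<And>v i. \<bar>h v $ i\<bar> \<le> \<bar>v $ i\<bar>"
    and "0 \<le> B" and "1 \<le> N" and g: "g \<in> snok_class D h T B \<X>"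
    and x: "\<And>i. i \<in> {1..N} \<Longrightarrow> x i \<in> \<X>" and e: "\<And>i. i \<in> {1..N} \<Longrightarrow> \<bar>e i\<bar> \<le> 1"
  shows "(\<Sum>i = 1..N. e i * g (x i)) \<le>
    B * (sqrt (((real N - 1) * snok_coherence D h T N x + 1) * real T) * frobenius_norm N x)"
proof -
  from g obtain w R where g: "g = restrict (\<lambda>x. w \<bullet> snok_state D h R x T) \<X>"
    and w: "norm w \<le> B" and R: "R \<in> admissible T"
    unfolding snok_class_def by blast
  let ?Y = "\<lambda>i. snok_state D h R (x i) T"
  let ?s = "\<Sum>i = 1..N. e i *\<^sub>R ?Y i"
  let ?\<mu> = "snok_coherence D h T N x"
  \<comment> \<open>\<open>N \<ge> 1\<close> keeps \<open>real N - 1\<close> nonnegative; the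
    coherence lies in [0, 1].\<close>
  have nonneg: "0 \<le> (real N - 1) * ?\<mu> + 1"
    using snok_coherence_bounds[of D h T N x] \<open>1 \<le> N\<close> by auto
  have "(norm ?s)\<^sup>2 \<le> ((real N - 1) * ?\<mu> + 1) * (\<Sum>i = 1..N. (norm (?Y i))\<^sup>2)"
    by (intro norm_signed_sum_le_coherence mutual_coherence_le_snok_coherence R e)
  also have "\<dots> \<le> ((real N - 1) * ?\<mu> + 1) * (\<Sum>i = 1..N. real T * (norm (x i))\<^sup>2)"
    by (intro mult_left_mono sum_mono norm_snok_state_le[OF D h R] nonneg) auto
  also have "\<dots> = (((real N - 1) * ?\<mu> + 1) * real T) * (frobenius_norm N x)\<^sup>2"
    by (simp add: frobenius_norm_power2 sum_distrib_left mult.assoc)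
  finally have "norm ?s \<le> sqrt ((((real N - 1) * ?\<mu> + 1) * real T) * (frobenius_norm N x)\<^sup>2)"
    by (rule real_le_rsqrt)
  then have s: "norm ?s \<le> sqrt (((real N - 1) * ?\<mu> + 1) * real T) * frobenius_norm N x"
    by (simp add: real_sqrt_mult frobenius_norm_def sum_nonneg)
  have "(\<Sum>i = 1..N. e i * g (x i)) = w \<bullet> ?s"
    using x by (simp add: g inner_sum_right)
  also have "\<dots> \<le> norm w * norm ?s"
    by (rule norm_cauchy_schwarz)
  also have "\<dots> \<le> B * (sqrt (((real N - 1) * ?\<mu> + 1) * real T) * frobenius_norm N x)"
    using w s \<open>0 \<le> B\<close> by (intro mult_mono) auto
  finally show ?thesis .
qed

text \<open>Supplies the bounds \<open>C i\<close>, uniform over the class, that the contraction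
  principle asks for.\<close>

lemma snok_class_bounded:
  fixes D :: "real ^ 'M::finite ^ 'd::finite"
  assumes D: "D ** transpose D = mat 1" and h: "\<And>v i. \<bar>h v $ i\<bar> \<le> \<bar>v $ i\<bar>"
    and "0 \<le> B" and g: "g \<in> snok_class D h T B \<X>" and "x \<in> \<X>"
  shows "\<bar>g x\<bar> \<le> B * sqrt (real T * (norm x)\<^sup>2)"
proof -
  from g obtain w R where g: "g = restrict (\<lambda>x. w \<bullet> snok_state D h R x T) \<X>"
    and w: "norm w \<le> B" and R: "R \<in> admissible T"
    unfolding snok_class_def by blast
  have "\<bar>g x\<bar> \<le> norm w * norm (snok_state D h R x T)"
    using \<open>x \<in> \<X>\<close> by (simp add: g Cauchy_Schwarz_ineq2)
  also have "\<dots> \<le> B * sqrt (real T * (norm x)\<^sup>2)"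
    using w \<open>0 \<le> B\<close> norm_snok_state_le[OF D h R order_refl]
    by (intro mult_mono real_le_rsqrt) auto
  finally show ?thesis .
qed

lemma snok_class_nonempty:
  fixes D :: "real ^ 'M::finite ^ 'd::finite"
  assumes "0 \<le> B"
  shows "snok_class D h T B \<X> \<noteq> {}"
proof -
  obtain R :: "nat \<Rightarrow> real ^ 'd ^ 'd" where "R \<in> admissible T" using admissible_nonempty by blast
  then have "restrict (\<lambda>x. 0 \<bullet> snok_state D h R x T) \<X> \<in> snok_class D h T B \<X>"
    unfolding snok_class_def using assms by (intro CollectI exI[of _ 0] exI[of _ R]) auto
  then show ?thesis by blast
qed

theorem theorem6:
  fixes k :: "'m::finite \<Rightarrow> nat" and col :: "'n::finite \<Rightarrow> nat"
    and h :: "real ^ ('n + 'n) \<Rightarrow> real ^ ('n + 'n)"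
    and \<X> :: "(real ^ ('m + 'm)) set" and \<Y> :: "'y set"
    and l :: "real \<Rightarrow> 'y \<Rightarrow> real"
    and x :: "nat \<Rightarrow> real ^ ('m + 'm)" and y :: "nat \<Rightarrow> 'y"
    and T N :: nat and B L :: real
  assumes "inj k" and "range k \<subseteq> {1..<CARD('n)}"
    and "bij_betw col UNIV {1..CARD('n)}"
    and "\<And>v i. \<bar>h v $ i\<bar> \<le> \<bar>v $ i\<bar>"
    and "T \<ge> 1" and "N \<ge> 1" and "B \<ge> 0"
    and "\<And>z b. b \<in> \<Y> \<Longrightarrow> l z b \<in> {0..1}"
    and "\<And>b. b \<in> \<Y> \<Longrightarrow> L-lipschitz_on UNIV (\<lambda>z. l z b)"
    and "\<And>i. i \<in> {1..N} \<Longrightarrow> x i \<in> \<X>" and "\<And>i. i \<in> {1..N} \<Longrightarrow> y i \<in> \<Y>"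
  shows "rademacher_complexity N (\<lambda>i. (x i, y i))
           (loss_class (shifted_loss l) (snok_class (spherical_matrix k col) h T B \<X>))
         \<le> L * B * sqrt (((real N - 1) * snok_coherence (spherical_matrix k col) h T N x + 1) * real T)
             / real N * frobenius_norm N x"
proof -
  let ?D = "spherical_matrix k col"
  let ?G = "snok_class ?D h T B \<X>"
  let ?P = "Pi_pmf {1..N} 0 (\<lambda>_. pmf_of_set {1, -1 :: real})"
  let ?K = "B * (sqrt (((real N - 1) * snok_coherence ?D h T N x + 1) * real T) * frobenius_norm N x)"
  note D = spherical_matrix_mult_transpose[OF assms(1-3)]
  note h = assms(4)
  \<comment> \<open>The first sample label provides an element of \<open>\<Y>\<close> at which the
    Lipschitz assumption applies.\<close>
  have "0 \<le> L"
    using lipschitz_on_nonneg[OF assms(9)[OF assms(11)[of 1]]] \<open>N \<ge> 1\<close> by simp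
  have fin: "finite (set_pmf ?P)"
    by (intro finite_set_pmf_Pi_pmf) auto
  have ne: "?G \<noteq> {}" using \<open>B \<ge> 0\<close> by (rule snok_class_nonempty)
  have "measure_pmf.expectation ?P
      (\<lambda>e. SUP f\<in>loss_class (shifted_loss l) ?G. \<Sum>i = 1..N. e i * f (x i, y i)) =
    measure_pmf.expectation ?P
      (\<lambda>e. SUP g\<in>?G. 0 + (\<Sum>i = 1..N. e i * shifted_loss l (g (x i)) (y i)))"
    by (simp add: loss_class_def image_image)
  also have "\<dots> \<le> measure_pmf.expectation ?P
      (\<lambda>e. SUP g\<in>?G. 0 + (\<Sum>i = 1..N. e i * (L * g (x i))))"
  \<comment> \<open>The offset is the constant 0, hence the summand \<open>0 +\<close> above.
    Subtracting \<open>l 0 (y i)\<close> leaves the Lipschitz constant of the loss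
    unchanged.\<close>
  proof (rule Rademacher_contraction[OF _ ne, where U = 0])
    show "L-lipschitz_on UNIV (\<lambda>z. shifted_loss l z (y i))" if "i \<in> {1..N}" for i
      using assms(9)[OF assms(11)[OF that]]
      by (simp add: lipschitz_on_def shifted_loss_def dist_real_def)
    show "\<bar>g (x i)\<bar> \<le> B * sqrt (real T * (norm (x i))\<^sup>2)" if "g \<in> ?G" "i \<in> {1..N}" for g i
      by (rule snok_class_bounded[OF D h \<open>B \<ge> 0\<close> that(1) assms(10)[OF that(2)]])
  qed auto
  also have "\<dots> \<le> L * ?K"
  proof (rule measure_pmf.integral_le_const)
    show "integrable (measure_pmf ?P) (\<lambda>e. SUP g\<in>?G. 0 + (\<Sum>i = 1..N. e i * (L * g (x i))))"
      by (rule integrable_measure_pmf_finite[OF fin])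
    \<comment> \<open>The bound holds for every sign vector in the support, so no averaging over
      signs is used here.\<close>
    show "AE e in measure_pmf ?P. (SUP g\<in>?G. 0 + (\<Sum>i = 1..N. e i * (L * g (x i)))) \<le> L * ?K"
    proof (rule AE_pmfI, rule cSUP_least[OF ne])
      fix e g assume "e \<in> set_pmf ?P" and g: "g \<in> ?G"
      then have "\<bar>e i\<bar> \<le> 1" if "i \<in> {1..N}" for i
        using that by (auto simp: set_Pi_pmf PiE_dflt_def)
      then have "(\<Sum>i = 1..N. e i * g (x i)) \<le> ?K"
        by (intro signed_sum_snok_class_le[OF D h \<open>B \<ge> 0\<close> \<open>N \<ge> 1\<close> g assms(10)])
      then have "L * (\<Sum>i = 1..N. e i * g (x i)) \<le> L * ?K"
        using \<open>0 \<le> L\<close> by (rule mult_left_mono)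
      then show "0 + (\<Sum>i = 1..N. e i * (L * g (x i))) \<le> L * ?K"
        by (simp add: sum_distrib_left mult.left_commute)
    qed
  qed
  finally have "1 / real N * measure_pmf.expectation ?P
      (\<lambda>e. SUP f\<in>loss_class (shifted_loss l) ?G. \<Sum>i = 1..N. e i * f (x i, y i)) \<le> 1 / real N * (L * ?K)"
    by (rule mult_left_mono) simp
  then show ?thesis
    by (simp add: rademacher_complexity_def rademacher_signs_def mult.assoc)
qed

end
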